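(* Let $T$ be a tree with vertex set $\{1,\dots,n\}$, $n\ge 2$, with edges $e_1,\dots,e_{n-1}$, and let $W_i$ be the $s\times s$ weight matrix of the edge $e_i$, $i=1,\dots,n-1$. Let $D$ be the distance matrix of $T$. Then $D$ is invertible if and only if all the weight matrices $W_i$, $i=1,\dots,n-1$, and the sum $\sum_{i=1}^{n-1}W_i$ are invertible. Moreover, suppose $D$ is invertible, and let $L$ be the Laplacian matrix of $T$ for the weighting in which each edge weight matrix is replaced by its inverse. For $i=1,\dots,n$ set $\delta_i=2-d_i$, where $d_i$ is the degree of the vertex $i$, and $\delta^T=[\delta_1,\dots,\delta_n]$. Then $$D^{-1}=-\frac12 L+\frac12\,\delta\delta^T\otimes\Big(\sum_{i=1}^{n-1}W_i\Big)^{-1}.$$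
   Context: Matrices have real entries. The distance matrix $D$ of $T$ is the $ns\times ns$ block matrix with $s\times s$ blocks $D_{i,j}$, where $D_{i,j}$ is the sum of the weight matrices of the edges on the unique path from $i$ to $j$ in $T$ (so $D_{i,i}=0$). The matrix $L$ is the $ns\times ns$ block matrix whose $(i,i)$ block is the sum of $W_k^{-1}$ over all edges $e_k$ incident with $i$, and whose $(i,j)$ block for $i\neq j$ is $-W_k^{-1}$ if $e_k=\{i,j\}$ is an edge and the zero matrix otherwise. The Kronecker product of $A=(a_{ij})$ and $B$ is the block matrix $A\otimes B=(a_{ij}B)$. The weights $W_i$ are not assumed symmetric. *)

theory Defs
  imports "HOL-Analysis.Analysis"
begin

text \<open>
  A simple graph is given by a vertex set \<open>V\<close> and a set \<open>E\<close> of two-element subsets of \<open>V\<close>;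
  paths and cycles are lists of pairwise distinct vertices.
\<close>

definition is_path :: "'v set set \<Rightarrow> 'v \<Rightarrow> 'v \<Rightarrow> 'v list \<Rightarrow> bool" where
  "is_path E u v p \<longleftrightarrow>
     p \<noteq> [] \<and> hd p = u \<and> last p = v \<and> distinct p \<and> successively (\<lambda>x y. {x, y} \<in> E) p"

definition is_cycle :: "'v set set \<Rightarrow> 'v list \<Rightarrow> bool" where
  "is_cycle E c \<longleftrightarrow>
     length c \<ge> 3 \<and> distinct c \<and> successively (\<lambda>x y. {x, y} \<in> E) c \<and> {last c, hd c} \<in> E"

definition is_tree :: "'v set \<Rightarrow> 'v set set \<Rightarrow> bool" where
  "is_tree V E \<longleftrightarrow>
     finite V \<and> V \<noteq> {} \<and> (\<forall>f\<in>E. f \<subseteq> V \<and> card f = 2) \<and>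
     (\<forall>u\<in>V. \<forall>v\<in>V. \<exists>p. is_path E u v p) \<and> (\<nexists>c. is_cycle E c)"

definition vertex_degree :: "'v set set \<Rightarrow> 'v \<Rightarrow> nat" where
  "vertex_degree E v = card {f \<in> E. v \<in> f}"

definition path_edges :: "'v list \<Rightarrow> 'v set set" where
  "path_edges p = {{p ! m, p ! Suc m} | m. Suc m < length p}"

text \<open>The unique path between two vertices; only meaningful when the edges form a tree.\<close>

definition tree_path :: "'v set set \<Rightarrow> 'v \<Rightarrow> 'v \<Rightarrow> 'v list" where
  "tree_path E u v = (THE p. is_path E u v p)"

text \<open>
  An \<open>ns \<times> ns\<close> matrix partitioned into \<open>s \<times> s\<close> blocks has its rows and columns indexed by pairs
  (block index, index inside the block).
\<close>

definition block_matrix :: "('i::finite \<Rightarrow> 'j::finite \<Rightarrow> real^'b::finite^'a::finite) \<Rightarrow> real^('j \<times> 'b)^('i \<times> 'a)" where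
  "block_matrix B = (\<chi> r c. B (fst r) (fst c) $ snd r $ snd c)"

definition kronecker :: "real^'j^'i \<Rightarrow> real^'b^'a \<Rightarrow> real^('j \<times> 'b)^('i \<times> 'a)"
    (infixr "\<otimes>\<^sub>K" 70) where
  "A \<otimes>\<^sub>K B = block_matrix (\<lambda>i j. A $ i $ j *\<^sub>R B)"

text \<open>
  Below, the edges are \<open>e k\<close> for \<open>k \<in> K\<close>, where \<open>e\<close> is injective on \<open>K\<close>, and the edge \<open>e k\<close> has
  the weight matrix \<open>W k\<close>.
\<close>

definition distance_matrix ::
    "'k set \<Rightarrow> ('k \<Rightarrow> 'v::finite set) \<Rightarrow> ('k \<Rightarrow> real^'s^'s) \<Rightarrow> real^('v \<times> 's)^('v \<times> 's)" where
  "distance_matrix K e W =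
     block_matrix (\<lambda>i j. \<Sum>k\<in>{k\<in>K. e k \<in> path_edges (tree_path (e ` K) i j)}. W k)"

definition laplacian_matrix ::
    "'k set \<Rightarrow> ('k \<Rightarrow> 'v::finite set) \<Rightarrow> ('k \<Rightarrow> real^'s^'s) \<Rightarrow> real^('v \<times> 's)^('v \<times> 's)" where
  "laplacian_matrix K e W =
     block_matrix (\<lambda>i j.
       if i = j then \<Sum>k\<in>{k\<in>K. i \<in> e k}. W k
       else if \<exists>k\<in>K. e k = {i, j} then - W (THE k. k \<in> K \<and> e k = {i, j})
       else 0)"

definition delta_vec :: "'v set set \<Rightarrow> real^'v" where
  "delta_vec E = (\<chi> i. 2 - real (vertex_degree E i))"

end

theory Submission
  imports Defs
begin

text \<open>
  Removing an edge splits the tree into two sides; let \<open>\<sigma>\<close> be the \<open>\<plusminus>1\<close> vector distinguishing them.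
  The edge lies on the path from \<open>i\<close> to \<open>j\<close> iff \<open>\<sigma> i \<noteq> \<sigma> j\<close>, so with \<open>S\<close> the sum of the weights
  \<open>2 D = \<one>\<one>\<^sup>T \<otimes> S - (\<Sum>k. \<sigma>\<^sub>k \<sigma>\<^sub>k\<^sup>T \<otimes> W\<^sub>k)\<close>. In other words \<open>D\<close> is congruent, by a real \<open>n \<times> n\<close>
  matrix \<open>M\<close> with columns \<open>\<one>\<close> and \<open>\<sigma>\<^sub>k\<close>, to half of the block diagonal matrix with blocks \<open>S\<close>
  and \<open>- W\<^sub>k\<close>. The inverse of \<open>M\<close> is explicit: its rows are \<open>\<delta> / 2\<close> and half the signed incidence
  vectors \<open>b\<^sub>k\<close> of the edges, and \<open>L = (\<Sum>k. b\<^sub>k b\<^sub>k\<^sup>T \<otimes> W\<^sub>k\<^sup>-\<^sup>1)\<close>.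

  The columns of \<open>M\<close> are indexed by the vertices: the root \<open>r\<close> stands for \<open>\<one>\<close>, and every other
  vertex \<open>c\<close> for the edge from \<open>c\<close> to its parent.
\<close>

section \<open>Rooted trees and paths\<close>

lemma path_edges_singleton [simp]: "path_edges [x] = {}"
  by (simp add: path_edges_def)

lemma path_edges_Cons_Cons [simp]:
  "path_edges (x # y # p) = insert {x, y} (path_edges (y # p))"
proof -
  have "{{(x # y # p) ! m, (x # y # p) ! Suc m} | m. Suc m < length (x # y # p)} =
      (\<lambda>m. {(x # y # p) ! m, (x # y # p) ! Suc m}) ` {..<Suc (length p)}"
    by auto
  also have "\<dots> = insert {x, y} ((\<lambda>m. {(y # p) ! m, (y # p) ! Suc m}) ` {..<length p})"
    by (simp add: lessThan_Suc_eq_insert_0 image_image)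
  also have "\<dots> = insert {x, y} (path_edges (y # p))"
    by (auto simp: path_edges_def)
  finally show ?thesis by (simp only: path_edges_def)
qed

lemma path_edges_subset: "f \<in> path_edges p \<Longrightarrow> f \<subseteq> set p"
  by (auto simp: path_edges_def)

text \<open>Since the vertices are distinct, the start lies on the first edge only. The edge set
  thus determines the second vertex, and removing the first edge from both sets leaves the same
  situation for the tails.\<close>

lemma path_eq_if_path_edges_eq:
  assumes "p \<noteq> []" "q \<noteq> []" "hd p = hd q" "distinct p" "distinct q" "path_edges p = path_edges q"
  shows "p = q"
  using assms
proof (induction p arbitrary: q)
  case Nil
  then show ?case by simp
next
  case (Cons x p)
  then obtain q' where q: "q = x # q'" by (cases q) auto
  show ?case
  proof (cases p)
    case Nil
    then show ?thesis using Cons.prems q by (cases q') auto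
  next
    case (Cons a p')
    note p = this
    from Cons.prems q p obtain b q'' where q': "q' = b # q''" by (cases q') auto
    have notin: "f \<notin> path_edges l" if "x \<in> f" "x \<notin> set l" for f and l :: "'a list"
      using path_edges_subset that by blast
    have x: "x \<notin> set (a # p')" "x \<notin> set (b # q'')"
      using Cons.prems q q' p by auto
    have eq: "insert {x, a} (path_edges (a # p')) = insert {x, b} (path_edges (b # q''))"
      using Cons.prems q q' p by simp
    have "{x, a} = {x, b}"
      using eq notin[of "{x, a}" "b # q''"] x by blast
    then have ab: "a = b" by (auto simp: doubleton_eq_iff)
    have "path_edges (a # p') = path_edges (b # q'')"
      using eq notin x unfolding ab by (metis insertI1 insert_ident)
    then have "p = q'"
      using Cons.IH[of q'] Cons.prems q q' p ab by auto
    then show ?thesis using q by simp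
  qed
qed

text \<open>Here \<open>h\<close> labels the two sides of a cut whose only edge is \<open>f\<close>.
  Along the path the label flips exactly when \<open>f\<close> is traversed, and distinctness of the
  vertices lets this happen at most once.\<close>

lemma path_crosses_edge_iff:
  assumes "is_path E i j p"
    and cut: "\<And>u v. {u, v} \<in> E \<Longrightarrow> h u \<noteq> h v \<longleftrightarrow> {u, v} = f"
  shows "f \<in> path_edges p \<longleftrightarrow> h i \<noteq> (h j :: bool)"
  using assms(1)
proof (induction p arbitrary: i)
  case Nil
  then show ?case by (simp add: is_path_def)
next
  case (Cons x p)
  show ?case
  proof (cases p)
    case Nil
    then show ?thesis using Cons.prems by (auto simp: is_path_def)
  next
    case (Cons a p')
    note p = this
    have x: "x = i" "i \<notin> set (a # p')" and e: "{i, a} \<in> E" and path: "is_path E a j p"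
      using Cons.prems p by (auto simp: is_path_def)
    have "f \<noteq> {i, a}" if "f \<in> path_edges (a # p')"
      using path_edges_subset[OF that] x by auto
    moreover have "f \<in> path_edges (a # p') \<longleftrightarrow> h a \<noteq> h j"
      using Cons.IH[OF path] p by simp
    ultimately show ?thesis using cut[OF e] p x by auto
  qed
qed

text \<open>The tree is encoded by parent pointers: each non-root vertex names the edge to its
  parent, and \<open>depth\<close> keeps the pointers from looping.\<close>

locale rooted_tree =
  fixes E :: "'v::finite set set" and r :: 'v and par :: "'v \<Rightarrow> 'v" and depth :: "'v \<Rightarrow> nat"
  assumes E_eq: "E = (\<lambda>w. {w, par w}) ` (- {r})"
    and depth_par: "w \<noteq> r \<Longrightarrow> depth (par w) < depth w"
    and connected: "\<exists>p. is_path E i j p"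
begin

text \<open>The vertices with ancestor \<open>c\<close> form the subtree hanging below
  \<open>c\<close>, which is one of the two sides left when the edge from \<open>c\<close> to its
  parent is removed.\<close>

inductive ancestor :: "'v \<Rightarrow> 'v \<Rightarrow> bool" for c where
  refl: "ancestor c c"
| step: "w \<noteq> r \<Longrightarrow> ancestor c (par w) \<Longrightarrow> ancestor c w"

definition edge :: "'v \<Rightarrow> 'v set" where "edge w = {w, par w}"

lemma par_neq: "w \<noteq> r \<Longrightarrow> par w \<noteq> w"
  using depth_par by force

lemma edges_eq: "E = edge ` (- {r})"
  by (simp add: E_eq edge_def)

text \<open>Two different vertices with the same edge would be each other's parent, so
  \<open>depth\<close> would decrease in both directions.\<close>

lemma inj_on_edge: "inj_on edge (- {r})"
  by (rule inj_onI) (auto simp: edge_def doubleton_eq_iff dest!: depth_par)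

lemma ancestor_depth: "ancestor c w \<Longrightarrow> depth c \<le> depth w"
  by (induction rule: ancestor.induct) (auto dest: depth_par)

lemma ancestor_par_iff: "w \<noteq> r \<Longrightarrow> ancestor c (par w) \<longleftrightarrow> ancestor c w \<and> c \<noteq> w"
  using ancestor_depth[of w "par w"] depth_par[of w] ancestor.simps[of c w] by auto

lemma ancestor_root_iff: "ancestor c r \<longleftrightarrow> c = r"
  using ancestor.simps[of c r] by auto

text \<open>The ancestors of \<open>w\<close> are \<open>w\<close> itself and those of
  \<open>par w\<close>, so only the edge of \<open>c\<close> leaves the subtree below
  \<open>c\<close>. This supplies the cut required by \<open>path_crosses_edge_iff\<close>.\<close>

lemma ancestor_cut:
  assumes "{u, v} \<in> E" "c \<noteq> r"
  shows "ancestor c u \<noteq> ancestor c v \<longleftrightarrow> {u, v} = edge c"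
proof -
  from assms(1) obtain w where w: "w \<noteq> r" "{u, v} = edge w" by (auto simp: edges_eq)
  have "ancestor c w \<noteq> ancestor c (par w) \<longleftrightarrow> c = w"
    using ancestor_par_iff[OF w(1), of c] ancestor.refl[of w] by auto
  moreover have "edge w = edge c \<longleftrightarrow> w = c"
    using inj_on_edge w(1) assms(2) by (auto simp: inj_on_def)
  ultimately show ?thesis using w(2) by (auto simp: edge_def doubleton_eq_iff)
qed

lemma edge_in_path_edges_iff:
  assumes "is_path E i j p" "c \<noteq> r"
  shows "edge c \<in> path_edges p \<longleftrightarrow> ancestor c i \<noteq> ancestor c j"
  using path_crosses_edge_iff[OF assms(1)] ancestor_cut assms(2) by metis

lemma path_edges_in_edges: "is_path E i j p \<Longrightarrow> path_edges p \<subseteq> E"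
  by (auto simp: path_edges_def is_path_def successively_conv_nth)

text \<open>Which edges a path uses depends only on its endpoints, through the cuts, and a path is
  determined by its start and its edge set.\<close>

lemma path_unique:
  assumes "is_path E i j p" "is_path E i j q"
  shows "p = q"
proof (rule path_eq_if_path_edges_eq)
  show "path_edges p = path_edges q"
  proof -
    have "f \<in> path_edges p \<longleftrightarrow> f \<in> path_edges q" if "f \<in> E" for f
      using that edge_in_path_edges_iff[OF assms(1)] edge_in_path_edges_iff[OF assms(2)]
      by (auto simp: edges_eq)
    then show ?thesis
      using path_edges_in_edges[OF assms(1)] path_edges_in_edges[OF assms(2)] by blast
  qed
qed (use assms in \<open>auto simp: is_path_def\<close>)

lemma edge_in_tree_path_iff:
  "c \<noteq> r \<Longrightarrow> edge c \<in> path_edges (tree_path E i j) \<longleftrightarrow> ancestor c i \<noteq> ancestor c j"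
proof -
  assume c: "c \<noteq> r"
  have "is_path E i j (tree_path E i j)"
    unfolding tree_path_def using connected[of i j] path_unique by (metis theI)
  then show ?thesis using edge_in_path_edges_iff c by blast
qed

text \<open>The guard \<open>c \<noteq> r\<close> makes the vector of the root the all-ones
  vector.\<close>

definition side :: "'v \<Rightarrow> 'v \<Rightarrow> real" where
  "side c i = (if c \<noteq> r \<and> ancestor c i then - 1 else 1)"

definition incidence :: "'v \<Rightarrow> 'v \<Rightarrow> real" where
  "incidence c i = of_bool (i = par c) - of_bool (i = c)"

text \<open>By \<open>incidence_side\<close> and \<open>delta_side\<close> the vectors \<^term>\<open>side c\<close> have the dual basis \<open>\<delta> / 2\<close> (for the
  root) and \<^term>\<open>\<lambda>i. incidence c i / 2\<close> (for the other vertices).\<close>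

lemma incidence_side:
  assumes "c \<noteq> r"
  shows "(\<Sum>i\<in>UNIV. incidence c i * side l i) = (if c = l then 2 else 0)"
proof -
  have "(\<Sum>i\<in>UNIV. incidence c i * side l i) = side l (par c) - side l c"
    by (simp add: incidence_def left_diff_distrib sum_subtractf of_bool_def if_distrib[of "\<lambda>x. x * _"]
        cong: if_cong)
  also have "\<dots> = (if c = l then 2 else 0)"
    using ancestor_par_iff[OF assms, of l] ancestor.refl[of c] assms by (auto simp: side_def)
  finally show ?thesis .
qed

text \<open>Double counting: weighting \<open>x\<close> by degrees amounts to adding
  \<open>x\<close> at both ends of every edge. Subtracting this from twice the total of
  \<open>x\<close> leaves \<open>2 * x w - x w - x (par w)\<close> for each non-root
  \<open>w\<close>.\<close>

lemma delta_sum: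
  "(\<Sum>i\<in>UNIV. delta_vec E $ i * x i) = 2 * x r + (\<Sum>w\<in>- {r}. x w - x (par w))"
proof -
  have fin: "finite E" by simp
  have "(\<Sum>i\<in>UNIV. real (vertex_degree E i) * x i) = (\<Sum>i\<in>UNIV. \<Sum>f\<in>E. if i \<in> f then x i else 0)"
    unfolding vertex_degree_def sum.inter_filter[OF fin, symmetric] by simp
  also have "\<dots> = (\<Sum>f\<in>E. \<Sum>i\<in>f. x i)"
    by (subst sum.swap) (simp add: sum.If_cases)
  also have "\<dots> = (\<Sum>w\<in>- {r}. x w + x (par w))"
    unfolding edges_eq by (subst sum.reindex[OF inj_on_edge]) (simp add: edge_def par_neq[symmetric])
  finally have deg: "(\<Sum>i\<in>UNIV. real (vertex_degree E i) * x i) = (\<Sum>w\<in>- {r}. x w + x (par w))" .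
  have all: "(\<Sum>i\<in>UNIV. x i) = x r + (\<Sum>w\<in>- {r}. x w)"
    using sum.remove[of UNIV r x] by (simp add: Compl_eq_Diff_UNIV)
  show ?thesis
    by (simp add: delta_vec_def left_diff_distrib sum_subtractf deg sum.distrib all
        sum_distrib_left[symmetric])
qed

lemma delta_side: "(\<Sum>i\<in>UNIV. delta_vec E $ i * side l i) = (if r = l then 2 else 0)"
proof -
  \<comment> \<open>The vector \<open>side l\<close> changes only along the edge of
    \<open>l\<close>, from 1 at the parent to -1 at \<open>l\<close>.\<close>
  have "side l w - side l (par w) = (if w = l then - 2 else 0)" if "w \<noteq> r" for w
    using ancestor_par_iff[OF that, of l] ancestor.refl[of w] that by (auto simp: side_def)
  then have "(\<Sum>w\<in>- {r}. side l w - side l (par w)) = (if r = l then 0 else - 2)"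
    by simp
  moreover have "side l r = 1" by (simp add: side_def ancestor_root_iff)
  ultimately show ?thesis by (simp add: delta_sum)
qed

text \<open>The coefficient \<open>(1 - side c i * side c j) / 2\<close> is 1 if the edge of
  \<open>c\<close> separates \<open>i\<close> from \<open>j\<close> and 0 otherwise.\<close>

lemma sum_paths:
  fixes W :: "'k \<Rightarrow> 'a::real_vector"
  assumes idx: "bij_betw idx (- {r}) K" and e_idx: "\<And>c. c \<noteq> r \<Longrightarrow> e (idx c) = edge c"
  shows "(\<Sum>k\<in>{k\<in>K. e k \<in> path_edges (tree_path E i j)}. W k) =
    (\<Sum>c\<in>- {r}. ((1 - side c i * side c j) / 2) *\<^sub>R W (idx c))"
proof -
  have "finite K" using idx by (metis bij_betw_finite finite)
  then have "(\<Sum>k\<in>{k\<in>K. e k \<in> path_edges (tree_path E i j)}. W k) =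
      (\<Sum>k\<in>K. if e k \<in> path_edges (tree_path E i j) then W k else 0)"
    by (rule sum.inter_filter)
  also have "\<dots> = (\<Sum>c\<in>- {r}. if e (idx c) \<in> path_edges (tree_path E i j) then W (idx c) else 0)"
    by (rule sum.reindex_bij_betw[OF idx, symmetric])
  also have "\<dots> = (\<Sum>c\<in>- {r}. ((1 - side c i * side c j) / 2) *\<^sub>R W (idx c))"
    by (intro sum.cong refl) (auto simp: e_idx edge_in_tree_path_iff side_def)
  finally show ?thesis .
qed

text \<open>An edge contributes the square of a sign at each of its ends, hence 1, and the product
  of opposite signs between them, hence -1. Injectivity of \<open>edge\<close> gives the definite
  description in the Laplacian its value.\<close>

lemma laplacian_matrix_eq:
  fixes W :: "'k \<Rightarrow> real^'s::finite^'s"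
  assumes idx: "bij_betw idx (- {r}) K" and e_idx: "\<And>c. c \<noteq> r \<Longrightarrow> e (idx c) = edge c"
  shows "laplacian_matrix K e W =
    block_matrix (\<lambda>i j. \<Sum>c\<in>- {r}. (incidence c i * incidence c j) *\<^sub>R W (idx c))"
proof -
  have fin: "finite K" using idx by (metis bij_betw_finite finite)
  have inj: "k = idx c" if "k \<in> K" "c \<noteq> r" "e k = edge c" for k c
  proof -
    obtain d where d: "d \<noteq> r" "k = idx d"
      using idx \<open>k \<in> K\<close> by (auto simp: bij_betw_def)
    then have "edge d = edge c" using that e_idx by simp
    then have "d = c" using inj_onD[OF inj_on_edge] d that by simp
    then show ?thesis using d by simp
  qed
  have diag: "(\<Sum>k\<in>{k\<in>K. i \<in> e k}. W k) =
      (\<Sum>c\<in>- {r}. (incidence c i * incidence c i) *\<^sub>R W (idx c))" for i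
  proof -
    have "(\<Sum>k\<in>{k\<in>K. i \<in> e k}. W k) = (\<Sum>k\<in>K. if i \<in> e k then W k else 0)"
      using fin by (rule sum.inter_filter)
    also have "\<dots> = (\<Sum>c\<in>- {r}. if i \<in> e (idx c) then W (idx c) else 0)"
      by (rule sum.reindex_bij_betw[OF idx, symmetric])
    also have "\<dots> = (\<Sum>c\<in>- {r}. (incidence c i * incidence c i) *\<^sub>R W (idx c))"
      by (intro sum.cong refl) (auto simp: e_idx edge_def incidence_def dest: par_neq)
    finally show ?thesis .
  qed
  have off_diag: "(incidence c i * incidence c j) *\<^sub>R W (idx c) =
      (if edge c = {i, j} then - W (idx c) else 0)" if "i \<noteq> j" for c i j
    using that by (auto simp: edge_def incidence_def doubleton_eq_iff)
  have adjacent: "- W (THE k. k \<in> K \<and> e k = {i, j}) =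
      (\<Sum>c\<in>- {r}. (incidence c i * incidence c j) *\<^sub>R W (idx c))"
    if ij: "i \<noteq> j" and k: "k \<in> K" "e k = {i, j}" for i j k
  proof -
    obtain c where c: "c \<noteq> r" "k = idx c"
      using idx k by (auto simp: bij_betw_def)
    then have edge: "edge c = {i, j}" using e_idx k by simp
    have "(THE k. k \<in> K \<and> e k = {i, j}) = idx c"
    proof (rule the_equality)
      show "idx c \<in> K \<and> e (idx c) = {i, j}" using c k by simp
      show "l = idx c" if "l \<in> K \<and> e l = {i, j}" for l
        using inj[of l c] that c(1) edge by simp
    qed
    moreover have "edge d = {i, j} \<longleftrightarrow> d = c" if "d \<noteq> r" for d
      using inj_on_edge that c(1) edge by (auto simp: inj_on_def)
    then have "(\<Sum>d\<in>- {r}. (incidence d i * incidence d j) *\<^sub>R W (idx d)) =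
        (\<Sum>d\<in>- {r}. if d = c then - W (idx c) else 0)"
      by (intro sum.cong refl) (auto simp: off_diag[OF ij])
    ultimately show ?thesis using c(1) by simp
  qed
  have non_adjacent: "(\<Sum>c\<in>- {r}. (incidence c i * incidence c j) *\<^sub>R W (idx c)) = 0"
    if "i \<noteq> j" "\<not> (\<exists>k\<in>K. e k = {i, j})" for i j
  proof (rule sum.neutral, rule ballI)
    fix c assume c: "c \<in> - {r}"
    then have "idx c \<in> K" using idx by (auto simp: bij_betw_def)
    then have "edge c \<noteq> {i, j}" using c that(2) e_idx by auto
    then show "(incidence c i * incidence c j) *\<^sub>R W (idx c) = 0"
      by (simp add: off_diag[OF that(1)])
  qed
  show ?thesis
    unfolding laplacian_matrix_def using diag adjacent non_adjacent
    by (intro arg_cong[where f = block_matrix] ext) auto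
qed

end

section \<open>Choosing a root and parents\<close>

text \<open>Every non-root vertex has a neighbour closer to the root, to be taken as its parent. The
  resulting edges are distinct and number \<open>CARD('v) - 1\<close>, so they exhaust
  \<open>E\<close>.\<close>

lemma rooted_tree_exists:
  fixes E :: "'v::finite set set"
  assumes tree: "is_tree UNIV E" and card: "card E = CARD('v) - 1"
  shows "\<exists>r par depth. rooted_tree E r par depth"
proof -
  define R where "R = {(u, v). {u, v} \<in> E}"
  \<comment> \<open>Any vertex can serve as the root; \<open>depth\<close> is then the graph
    distance from it.\<close>
  define r :: 'v where "r = undefined"
  define depth where "depth v = (LEAST m. (r, v) \<in> R ^^ m)" for v
  have connected: "\<exists>p. is_path E i j p" for i j
    using tree by (simp add: is_tree_def)
  have reach: "\<exists>m. (i, j) \<in> R ^^ m" if "is_path E i j p" for i j p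
    using that
  proof (induction p arbitrary: i)
    case (Cons x p)
    show ?case
    proof (cases p)
      case Nil
      then have "(i, j) \<in> R ^^ 0" using Cons.prems by (auto simp: is_path_def)
      then show ?thesis by blast
    next
      case (Cons a p')
      then have "(i, a) \<in> R" "is_path E a j p"
        using Cons.prems by (auto simp: is_path_def R_def)
      then show ?thesis using Cons.IH relpow_Suc_I2 by metis
    qed
  qed (simp add: is_path_def)
  have depth: "(r, v) \<in> R ^^ depth v" for v
    unfolding depth_def using connected[of r v] reach by (meson LeastI)
  \<comment> \<open>The parent is the last vertex before \<open>v\<close> on a shortest walk from
    the root.\<close>
  have "\<exists>u. {v, u} \<in> E \<and> depth u < depth v" if nonroot: "v \<noteq> r" for v
  proof -
    obtain m where m: "depth v = Suc m"
      using depth[of v] nonroot by (cases "depth v") auto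
    then obtain u where u: "(r, u) \<in> R ^^ m" "(u, v) \<in> R"
      using depth[of v] by auto
    from u(1) have "depth u \<le> m" unfolding depth_def by (rule Least_le)
    then show ?thesis using m u(2) by (auto simp: R_def insert_commute)
  qed
  then obtain par where par: "\<And>v. v \<noteq> r \<Longrightarrow> {v, par v} \<in> E \<and> depth (par v) < depth v"
    by metis
  have "inj_on (\<lambda>w. {w, par w}) (- {r})"
  proof (rule inj_onI)
    fix v w assume "v \<in> - {r}" "w \<in> - {r}" "{v, par v} = {w, par w}"
    then show "v = w" using par[of v] par[of w] by (auto simp: doubleton_eq_iff)
  qed
  then have "card ((\<lambda>w. {w, par w}) ` (- {r})) = card E"
    by (simp add: card_image card Compl_eq_Diff_UNIV)
  then have "E = (\<lambda>w. {w, par w}) ` (- {r})"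
    using par by (intro card_subset_eq[symmetric]) auto
  then have "rooted_tree E r par depth"
    using par connected by (intro rooted_tree.intro) blast+
  then show ?thesis by blast
qed

section \<open>Block matrices\<close>

lemma block_matrix_mult:
  fixes A :: "'a::finite \<Rightarrow> 'b::finite \<Rightarrow> real^'c::finite^'d::finite"
    and B :: "'b \<Rightarrow> 'e::finite \<Rightarrow> real^'f::finite^'c"
  shows "block_matrix A ** block_matrix B = block_matrix (\<lambda>i j. \<Sum>k\<in>UNIV. A i k ** B k j)"
proof -
  have *: "(\<Sum>k\<in>UNIV. f (fst k) (snd k)) = (\<Sum>a\<in>UNIV. \<Sum>b\<in>UNIV. f a b)"
    for f :: "'b \<Rightarrow> 'c \<Rightarrow> real"
    by (simp add: sum.cartesian_product split_def flip: UNIV_Times_UNIV)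
  then show ?thesis
    by (simp add: vec_eq_iff block_matrix_def matrix_matrix_mult_def
        *[of "\<lambda>k l. A _ k $ _ $ l * B k _ $ l $ _"])
qed

lemma block_matrix_eq_iff: "block_matrix A = block_matrix B \<longleftrightarrow> (\<forall>i j. A i j = B i j)"
  by (auto simp: block_matrix_def vec_eq_iff)

lemma block_matrix_cases:
  obtains B where "A = block_matrix B"
  by (rule that[of "\<lambda>i j. \<chi> a b. A $ (i, a) $ (j, b)"]) (simp add: block_matrix_def vec_eq_iff)

lemma scaleR_block_matrix: "c *\<^sub>R block_matrix A = block_matrix (\<lambda>i j. c *\<^sub>R A i j)"
  by (simp add: block_matrix_def vec_eq_iff)

lemma add_block_matrix: "block_matrix A + block_matrix B = block_matrix (\<lambda>i j. A i j + B i j)"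
  by (simp add: block_matrix_def vec_eq_iff)

lemma mat_1_block_matrix:
  "mat 1 = block_matrix (\<lambda>i j. if i = j then mat 1 else 0)"
  by (auto simp: block_matrix_def vec_eq_iff mat_def prod_eq_iff)

lemma kronecker_mult:
  fixes A :: "real^'k::finite^'i::finite" and B :: "real^'b::finite^'a::finite"
  shows "(A \<otimes>\<^sub>K B) ** (A' \<otimes>\<^sub>K B') = (A ** A') \<otimes>\<^sub>K (B ** B')"
  unfolding kronecker_def block_matrix_mult block_matrix_eq_iff
  by (simp add: matrix_matrix_mult_def vec_eq_iff sum_distrib_left sum_distrib_right mult_ac)

lemma kronecker_mat_1: "(mat 1 :: real^'i::finite^'i) \<otimes>\<^sub>K (mat 1 :: real^'a::finite^'a) = mat 1"
  by (auto simp: kronecker_def block_matrix_def mat_def vec_eq_iff prod_eq_iff)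

text \<open>For square matrices a right inverse is two-sided, so the choice in
  \<open>matrix_inv\<close> has a witness, and inverses are unique.\<close>

lemma matrix_inv_eqI:
  fixes A :: "real^'a::finite^'a"
  assumes "A ** B = mat 1"
  shows "matrix_inv A = B"
proof -
  have "A ** matrix_inv A = mat 1 \<and> matrix_inv A ** A = mat 1"
    unfolding matrix_inv_def using assms matrix_left_right_inverse[of A B] by (intro someI) blast
  then have "matrix_inv A = matrix_inv A ** (A ** B)"
    by (simp add: assms)
  also have "\<dots> = B"
    using \<open>A ** matrix_inv A = mat 1 \<and> _\<close> by (simp add: matrix_mul_assoc)
  finally show ?thesis .
qed

lemma matrix_inv_right:
  fixes A :: "real^'a::finite^'a"
  shows "invertible A \<Longrightarrow> A ** matrix_inv A = mat 1"
  using matrix_inv_eqI by (auto simp: invertible_right_inverse)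

lemma uminus_matrix_mult_uminus: "(- A) ** (- B) = A ** B"
  for A :: "real^'b::finite^'a::finite" and B :: "real^'c::finite^'b"
  by (simp add: matrix_matrix_mult_def vec_eq_iff)

lemma invertible_uminus_iff: "invertible (- A) \<longleftrightarrow> invertible A"
  for A :: "real^'a::finite^'a"
  unfolding invertible_right_inverse by (metis uminus_matrix_mult_uminus minus_minus)

definition block_diag :: "('i::finite \<Rightarrow> real^'a::finite^'a) \<Rightarrow> real^('i \<times> 'a)^('i \<times> 'a)" where
  "block_diag Z = block_matrix (\<lambda>i j. if i = j then Z i else 0)"

lemma block_diag_mult: "block_diag Z ** block_diag Z' = block_diag (\<lambda>i. Z i ** Z' i)"
  by (simp add: block_diag_def block_matrix_mult block_matrix_eq_iff
      if_distrib[of "\<lambda>x. x ** _"] if_distrib[of "\<lambda>x. _ ** x"] cong: if_cong)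

lemma block_diag_mat_1: "block_diag (\<lambda>i. mat 1) = mat 1"
  by (simp add: block_diag_def mat_1_block_matrix)

text \<open>The diagonal blocks of an inverse invert the blocks \<open>Z i\<close>; conversely the
  inverse is formed blockwise.\<close>

lemma invertible_block_diag_iff: "invertible (block_diag Z) \<longleftrightarrow> (\<forall>i. invertible (Z i))"
proof
  assume "invertible (block_diag Z)"
  then obtain B where "block_diag Z ** B = mat 1" by (auto simp: invertible_def)
  moreover obtain B' where "B = block_matrix B'" by (rule block_matrix_cases)
  ultimately have *: "(\<Sum>k\<in>UNIV. (if i = k then Z i else 0) ** B' k j) = (if i = j then mat 1 else 0)" for i j
    by (simp add: block_diag_def block_matrix_mult block_matrix_eq_iff mat_1_block_matrix)
  have "Z i ** B' i i = mat 1" for i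
    using *[of i i] by (simp add: if_distrib[of "\<lambda>x. x ** _"] cong: if_cong)
  then show "\<forall>i. invertible (Z i)" by (auto simp: invertible_right_inverse)
next
  assume "\<forall>i. invertible (Z i)"
  then have "block_diag Z ** block_diag (\<lambda>i. matrix_inv (Z i)) = mat 1"
    by (simp add: block_diag_mult matrix_inv_right block_diag_mat_1)
  then show "invertible (block_diag Z)" by (auto simp: invertible_right_inverse)
qed

section \<open>Congruence with a block diagonal matrix\<close>

text \<open>This converts between sums over edges and matrix products; it serves both
  \<open>D\<close> and its inverse.\<close>

lemma kronecker_block_diag_kronecker:
  fixes A :: "real^'k::finite^'i::finite"
  shows "(A \<otimes>\<^sub>K mat 1) ** block_diag Z ** (B \<otimes>\<^sub>K mat 1) =
    block_matrix (\<lambda>i j. \<Sum>c\<in>UNIV. (A $ i $ c * B $ c $ j) *\<^sub>R Z c)"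
  by (simp add: kronecker_def block_diag_def block_matrix_mult block_matrix_eq_iff mult.commute
      if_distrib[of "\<lambda>x. _ ** x"] matrix_scalar_ac cong: if_cong flip: scalar_matrix_assoc)

text \<open>The inner factors cancel from the middle outwards, leaving \<open>X ** Y\<close>, which
  is the identity because a left inverse of a square matrix is also a right inverse.\<close>

lemma congruence_inverse:
  fixes X Z X' :: "real^'a::finite^'a"
  assumes YX: "Y ** X = mat 1" and X'Y': "X' ** Y' = mat 1" and "c \<noteq> 0" and Z: "Z ** Zi = mat 1"
  shows "(c *\<^sub>R (X ** Z ** X')) ** ((1 / c) *\<^sub>R (Y' ** Zi ** Y)) = mat 1"
proof -
  have "(c *\<^sub>R (X ** Z ** X')) ** ((1 / c) *\<^sub>R (Y' ** Zi ** Y)) = X ** Z ** X' ** (Y' ** Zi ** Y)"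
    using \<open>c \<noteq> 0\<close> by (simp add: matrix_scalar_ac flip: scalar_matrix_assoc)
  also have "\<dots> = X ** (Z ** (X' ** Y') ** Zi) ** Y"
    by (simp only: matrix_mul_assoc)
  also have "\<dots> = mat 1"
    using YX by (simp add: X'Y' Z matrix_left_right_inverse)
  finally show ?thesis .
qed

lemma invertible_congruence_iff:
  fixes X Z X' :: "real^'a::finite^'a"
  assumes YX: "Y ** X = mat 1" and X'Y': "X' ** Y' = mat 1" and "c \<noteq> 0"
  shows "invertible (c *\<^sub>R (X ** Z ** X')) \<longleftrightarrow> invertible Z"
proof
  assume "invertible (c *\<^sub>R (X ** Z ** X'))"
  then obtain B where B: "(c *\<^sub>R (X ** Z ** X')) ** B = mat 1"
    by (auto simp: invertible_right_inverse)
  \<comment> \<open>Inserting \<open>Y ** X\<close> before \<open>Z\<close> completes the congruent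
    matrix, which \<open>B\<close> then cancels.\<close>
  have "Z ** ((c *\<^sub>R X') ** B ** X) = (Y ** X) ** Z ** (c *\<^sub>R X') ** B ** X"
    by (simp add: YX matrix_mul_assoc)
  also have "\<dots> = Y ** ((c *\<^sub>R (X ** Z ** X')) ** B) ** X"
    by (simp add: matrix_mul_assoc matrix_scalar_ac flip: scalar_matrix_assoc)
  also have "\<dots> = mat 1" by (simp add: B YX)
  finally show "invertible Z" by (auto simp: invertible_right_inverse)
next
  assume "invertible Z"
  then show "invertible (c *\<^sub>R (X ** Z ** X'))"
    using congruence_inverse[OF assms matrix_inv_right] by (auto simp: invertible_right_inverse)
qed

section \<open>Invertibility and inverse of the distance matrix\<close>

theorem theorem3p2:
  fixes E :: "'v::finite set set"
    and e :: "nat \<Rightarrow> 'v set"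
    and W :: "nat \<Rightarrow> real^'s::finite^'s"
    and n :: nat
    and D L :: "real^('v \<times> 's)^('v \<times> 's)"
    and \<delta> :: "real^'v"
  assumes n_def: "n = CARD('v)"
    and n_ge_2: "n \<ge> 2"
    and tree: "is_tree (UNIV :: 'v set) E"
    and edges: "bij_betw e {1..n - 1} E"
    and D_def: "D = distance_matrix {1..n - 1} e W"
    and L_def: "L = laplacian_matrix {1..n - 1} e (\<lambda>k. matrix_inv (W k))"
    and \<delta>_def: "\<delta> = delta_vec E"
  shows "(invertible D \<longleftrightarrow>
            (\<forall>i\<in>{1..n - 1}. invertible (W i)) \<and> invertible (\<Sum>i=1..n - 1. W i)) \<and>
         (invertible D \<longrightarrow>
            matrix_inv D =
              - (1/2) *\<^sub>R L
              + (1/2) *\<^sub>R (((columnvector \<delta> :: real^1^'v) ** rowvector \<delta>)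
                          \<otimes>\<^sub>K matrix_inv (\<Sum>i=1..n - 1. W i)))"
proof -
  let ?K = "{1..n - 1}" and ?S = "\<Sum>i=1..n - 1. W i"
  have "card E = CARD('v) - 1"
    using bij_betw_same_card[OF edges] n_def by simp
  then obtain r par depth where "rooted_tree E r par depth"
    using rooted_tree_exists[OF tree] by blast
  then interpret rooted_tree E r par depth .
  \<comment> \<open>A non-root vertex is sent to the index of the edge to its parent.\<close>
  define idx where "idx = inv_into ?K e \<circ> edge"
  have idx: "bij_betw idx (- {r}) ?K"
    unfolding idx_def using inj_on_edge edges_eq bij_betw_inv_into[OF edges]
    by (intro bij_betw_trans[of _ _ E]) (auto simp: bij_betw_def)
  have e_idx: "e (idx c) = edge c" if "c \<noteq> r" for c
  proof -
    have "edge c \<in> e ` ?K" using that edges edges_eq by (auto simp: bij_betw_def)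
    then show ?thesis by (simp add: idx_def f_inv_into_f)
  qed
  have S_eq: "?S = (\<Sum>c\<in>- {r}. W (idx c))"
    by (rule sum.reindex_bij_betw[OF idx, symmetric])
  have UNIV_eq: "sum f UNIV = f r + sum f (- {r})" for f :: "'v \<Rightarrow> real^'s^'s"
    using sum.remove[of UNIV r f] by (simp add: Compl_eq_Diff_UNIV)

  define M :: "real^'v^'v" where "M = (\<chi> i c. side c i)"
  define N :: "real^'v^'v" where "N = (\<chi> c i. (if c = r then \<delta> $ i else incidence c i) / 2)"
  define Z where "Z c = (if c = r then ?S else - W (idx c))" for c
  define Z' where "Z' c = (if c = r then matrix_inv ?S else - matrix_inv (W (idx c)))" for c
  let ?I = "mat 1 :: real^'s^'s"

  have "(\<Sum>i\<in>UNIV. N $ c $ i * M $ i $ l) = (if c = l then 1 else 0)" for c l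
    using delta_side[of l] incidence_side[of c l]
    by (cases "c = r") (auto simp: M_def N_def \<delta>_def sum_divide_distrib[symmetric])
  then have NM: "N ** M = mat 1"
    by (simp add: matrix_matrix_mult_def mat_def)
  then have YX: "(N \<otimes>\<^sub>K ?I) ** (M \<otimes>\<^sub>K ?I) = mat 1"
    by (simp add: kronecker_mult kronecker_mat_1)
  have XY: "(transpose M \<otimes>\<^sub>K ?I) ** (transpose N \<otimes>\<^sub>K ?I) = mat 1"
    by (simp add: kronecker_mult kronecker_mat_1 NM transpose_mat flip: matrix_transpose_mul)

  have E_eq_image: "e ` ?K = E" using edges by (simp add: bij_betw_def)
  have "(\<Sum>k\<in>{k\<in>?K. e k \<in> path_edges (tree_path E i j)}. W k) =
      (1/2) *\<^sub>R (\<Sum>c\<in>UNIV. (side c i * side c j) *\<^sub>R Z c)" for i j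
  proof -
    \<comment> \<open>The root term is all of \<open>?S\<close>; expanded over the edges it supplies
      the 1 in each coefficient \<open>1 - side c i * side c j\<close>.\<close>
    have "side r l = 1" for l by (simp add: side_def)
    then have "(1/2) *\<^sub>R (\<Sum>c\<in>UNIV. (side c i * side c j) *\<^sub>R Z c) =
        (\<Sum>c\<in>- {r}. (1/2) *\<^sub>R (W (idx c) - (side c i * side c j) *\<^sub>R W (idx c)))"
      unfolding UNIV_eq Z_def S_eq
      by (simp add: sum_negf sum_subtractf flip: scaleR_sum_right)
    also have "\<dots> = (\<Sum>c\<in>- {r}. ((1 - side c i * side c j) / 2) *\<^sub>R W (idx c))"
      by (simp add: scaleR_diff_right scaleR_diff_left diff_divide_distrib)
    also have "\<dots> = (\<Sum>k\<in>{k\<in>?K. e k \<in> path_edges (tree_path E i j)}. W k)"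
      by (rule sum_paths[OF idx e_idx, symmetric])
    finally show ?thesis by simp
  qed
  then have D_eq: "D = (1/2) *\<^sub>R ((M \<otimes>\<^sub>K ?I) ** block_diag Z ** (transpose M \<otimes>\<^sub>K ?I))"
    unfolding D_def distance_matrix_def E_eq_image kronecker_block_diag_kronecker
    by (simp add: scaleR_block_matrix block_matrix_eq_iff M_def transpose_def)

  have "invertible D \<longleftrightarrow> (\<forall>c. invertible (Z c))"
    unfolding D_eq using invertible_congruence_iff[OF YX XY] by (simp add: invertible_block_diag_iff)
  also have "\<dots> \<longleftrightarrow> (\<forall>c\<in>- {r}. invertible (W (idx c))) \<and> invertible ?S"
    by (auto simp: Z_def invertible_uminus_iff)
  also have "\<dots> \<longleftrightarrow> (\<forall>i\<in>?K. invertible (W i)) \<and> invertible ?S"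
    unfolding bij_betw_imp_surj_on[OF idx, symmetric] by simp
  finally have inv_iff: "invertible D \<longleftrightarrow> (\<forall>i\<in>?K. invertible (W i)) \<and> invertible ?S" .

  have "matrix_inv D = - (1/2) *\<^sub>R L
      + (1/2) *\<^sub>R (((columnvector \<delta> :: real^1^'v) ** rowvector \<delta>) \<otimes>\<^sub>K matrix_inv ?S)"
    if "invertible D"
  proof -
    have L_eq: "L = block_matrix (\<lambda>i j. \<Sum>c\<in>- {r}. (incidence c i * incidence c j) *\<^sub>R matrix_inv (W (idx c)))"
      unfolding L_def by (rule laplacian_matrix_eq[OF idx e_idx])
    have inv: "invertible (W (idx c))" if "c \<noteq> r" for c
      using \<open>invertible D\<close> that idx unfolding inv_iff by (auto simp: bij_betw_def)
    have "Z c ** Z' c = mat 1" for c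
      using \<open>invertible D\<close> inv unfolding inv_iff
      by (simp add: Z_def Z'_def matrix_inv_right uminus_matrix_mult_uminus)
    then have "block_diag Z ** block_diag Z' = mat 1"
      by (simp add: block_diag_mult block_diag_mat_1)
    \<comment> \<open>The factor 2 is the reciprocal of the 1/2 in \<open>D_eq\<close>.\<close>
    then have "D ** (2 *\<^sub>R ((transpose N \<otimes>\<^sub>K ?I) ** block_diag Z' ** (N \<otimes>\<^sub>K ?I))) = mat 1"
      unfolding D_eq using congruence_inverse[OF YX XY, of "1/2"] by simp
    then have "matrix_inv D = 2 *\<^sub>R ((transpose N \<otimes>\<^sub>K ?I) ** block_diag Z' ** (N \<otimes>\<^sub>K ?I))"
      by (rule matrix_inv_eqI)
    also have "\<dots> = block_matrix (\<lambda>i j. 2 *\<^sub>R (\<Sum>c\<in>UNIV. (N $ c $ i * N $ c $ j) *\<^sub>R Z' c))"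
      unfolding kronecker_block_diag_kronecker scaleR_block_matrix by (simp add: transpose_def)
    also have "\<dots> = block_matrix (\<lambda>i j. - (1/2) *\<^sub>R (\<Sum>c\<in>- {r}. (incidence c i * incidence c j) *\<^sub>R matrix_inv (W (idx c)))
        + (1/2) *\<^sub>R ((\<delta> $ i * \<delta> $ j) *\<^sub>R matrix_inv ?S))"
    proof (intro arg_cong[where f = block_matrix] ext)
      fix i j
      let ?B = "\<Sum>c\<in>- {r}. (incidence c i * incidence c j) *\<^sub>R matrix_inv (W (idx c))"
      \<comment> \<open>Each factor from \<open>N\<close> carries 1/2, which gives 1/4, and the sign
        comes from \<open>Z'\<close>; the outer factor 2 later turns 1/4 into 1/2.\<close>
      have "(\<Sum>c\<in>- {r}. (N $ c $ i * N $ c $ j) *\<^sub>R Z' c) = - (1/4) *\<^sub>R ?B"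
        unfolding scaleR_sum_right by (intro sum.cong refl) (auto simp: N_def Z'_def vec_eq_iff)
      then have "(\<Sum>c\<in>UNIV. (N $ c $ i * N $ c $ j) *\<^sub>R Z' c) =
          (1/4) *\<^sub>R ((\<delta> $ i * \<delta> $ j) *\<^sub>R matrix_inv ?S) + - (1/4) *\<^sub>R ?B"
        unfolding UNIV_eq by (simp add: N_def Z'_def)
      then show "2 *\<^sub>R (\<Sum>c\<in>UNIV. (N $ c $ i * N $ c $ j) *\<^sub>R Z' c) =
          - (1/2) *\<^sub>R ?B + (1/2) *\<^sub>R ((\<delta> $ i * \<delta> $ j) *\<^sub>R matrix_inv ?S)"
        by (simp add: scaleR_diff_right)
    qed
    also have "\<dots> = - (1/2) *\<^sub>R L
        + (1/2) *\<^sub>R (((columnvector \<delta> :: real^1^'v) ** rowvector \<delta>) \<otimes>\<^sub>K matrix_inv ?S)"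
      unfolding L_eq kronecker_def scaleR_block_matrix add_block_matrix
      by (simp add: columnvector_def rowvector_def matrix_matrix_mult_def)
    finally show ?thesis .
  qed
  with inv_iff show ?thesis by blast
qed

end
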